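(* Suppose that the minimum dwell time assumption (A) and the terminal set assumption (B) stated in the context hold. Then the MPC scheme described in the context is recursively $\delta$-feasible; that is, if the problem $P_0(l,\emptyset)$ is feasible, then for every sampling instant $i\in\mathbb{N}$ the problem $P_i(h,b_{act})$, with $(h,b_{act})$ the parameter pair generated by the scheme at instant $i$, is $\delta$-feasible.
   Context: Data. $\mathcal X\subseteq\mathbb R^{n_x}$ is closed, $\mathcal U\subset\mathbb R^{n_u}$ is compact, $\mathcal X_f\subseteq\mathcal X$ is the terminal set, $Q\in\mathbb N$ is the number of modes, $g:\mathbb R^{n_x}\times\mathbb R^{n_u}\to\mathbb R^c$, the stage costs $L_j:\mathbb R^{n_x}\times\mathbb R^{n_u}\to\mathbb R$ ($j=1,\dots,Q$) and the terminal cost $\psi:\mathbb R^{n_x}\to\mathbb R$ are $\mathcal C^2$. The map $\phi:\mathbb R^{n_x}\times\mathbb R^{n_u}\times[0,1]^Q\to\mathbb R^{n_x}$ is a one-step numerical integration operator (e.g. Euler or Runge–Kutta with step $\Delta t$) for $\dot x=\sum_{j=1}^Q b^jf_j(x,u)$, where each $f_j:\mathbb R^{n_x}\times\mathbb R^{n_u}\to\mathbb R^{n_x}$ is $\mathcal C^2$. The sampling time is $\Delta t=(t_f-t_0)/N>0$, the minimum dwell time is $\underline{\Delta\tau}>0$, $l=\lceil\underline{\Delta\tau}/\Delta t\rceil$, and $Ml=N$ with $M\in\mathbb N$. Problem $P_i(h,b_{act})$, for $h\in\{1,\dots,l\}$ and $b_{act}\in\{0,1\}^Q$ a unit vector or $b_{act}=\emptyset$.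 Put $N_h=h+(M-1)l$ (so $N_l=N$). Block index: $m(k)=0$ for $0\le k\le h-1$, and $m(k)=m$ for $h+(m-1)l\le k\le h+ml-1$, $m=1,\dots,M-1$. Given the current state $\tilde x_{0|i}$, minimize $$\psi(x_{N_h|i})+\sum_{k=0}^{N_h-1}\sum_{j=1}^Q\hat p^{\,j}_{m(k)|i}L_j(x_{k|i},u_{k|i})$$ over $x_{0|i},\dots,x_{N_h|i}$, $u_{0|i},\dots,u_{N_h-1|i}$ and $\hat{\mathbf p}_{0|i},\dots,\hat{\mathbf p}_{M-1|i}\in[0,1]^Q$, subject to: $\hat{\mathbf p}_{0|i}=b_{act}$ (no such constraint if $b_{act}=\emptyset$); $x_{0|i}=\tilde x_{0|i}$; $x_{k+1|i}=\phi(x_{k|i},u_{k|i},\hat{\mathbf p}_{m(k)|i})$, $x_{k|i}\in\mathcal X$, $u_{k|i}\in\mathcal U$ and $g(x_{k|i},u_{k|i})\le0$ for $k=0,\dots,N_h-1$; $x_{N_h|i}\in\mathcal X_f$; $\sum_{j=1}^Q\hat p^{\,j}_{m|i}=1$ for $m=0,\dots,M-1$. MPC scheme. Initialize $h\leftarrow l$, $b_{act}\leftarrow\emptyset$. For $i=0,1,2,\dots$: 1. (NLP #1) Solve $P_i(h,b_{act})$ to obtain an optimal $\hat{\mathbf p}_i=(\hat{\mathbf p}_{0|i},\dots,\hat{\mathbf p}_{M-1|i})$. 2. (Rounding) Compute $\mathbf p_i=(\mathbf p_{0|i},\dots,\mathbf p_{M-1|i})$ by sum-up-rounding (SUR): for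 $m=0,\dots,M-1$, set $s_m^j=\big(\sum_{r=0}^m\hat p^{\,j}_{r|i}-\sum_{r=0}^{m-1}p^{\,j}_{r|i}\big)l\Delta t$ for $j=1,\dots,Q$, and let $p^{\,j}_{m|i}=1$ if $j$ is the smallest index maximizing $s_m^{\cdot}$, and $p^{\,j}_{m|i}=0$ otherwise. 3. (NLP #2) Solve $P_i(h,b_{act})$ with $\hat{\mathbf p}_i$ fixed to $\mathbf p_i$, obtaining optimal $x_{k|i},u_{k|i}$. 4. Apply $u_{0|i},\mathbf p_{0|i}$ to the system. Set $h\leftarrow h-1$; if now $h=0$, set $h\leftarrow l$ and $b_{act}\leftarrow\emptyset$; otherwise set $b_{act}\leftarrow\mathbf p_{0|i}$. The setting is nominal: the next measured state is $\tilde x_{0|i+1}=\phi(\tilde x_{0|i},u_{0|i},\mathbf p_{0|i})$. Each "solve" step returns an optimal solution whenever the problem is feasible. $\delta$-feasibility. Suppose $P_i(h,b_{act})$ is feasible; let $(\hat x,u^*,\hat{\mathbf p})$ be its optimal solution (NLP #1) with cost $J(\hat x,u^* )$, let $\mathbf p$ be obtained from $\hat{\mathbf p}$ by SUR, let $x$ be the state trajectory generated from the same initial state by the same input $u^*$ with $\mathbf p$ in place of $\hat{\mathbf p}$, and let $J(x,u^* )$ be the corresponding cost. The trajectory $(x,u^* )$ and the problem $P_i(h,b_{act})$ are called $\delta$-feasible if there exist $\delta_1,\delta_2,\delta_3\ge0$ such that $\|x-\hat x\|_\infty\le\delta_1$, $|J(x,u^* )-J(\hat x,u^* )|\le\delta_2$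 and $\|g(x,u^* )-g(\hat x,u^* )\|_\infty\le\delta_3$ along the horizon, where moreover $(\hat x,u^* )$ lies at a distance, characterized by $\delta_1$ and $\delta_3$, from the boundary of the feasible region such that the trajectory $(x,u^* )$ obtained after SUR is feasible, i.e. $(x,u^*,\mathbf p)$ satisfies all constraints of $P_i(h,b_{act})$. Assumption (A) (minimum dwell time). For a given $\epsilon>0$, $\underline{\Delta\tau}\le\dfrac{\epsilon}{\sum_{c=2}^C 1/c}-\Delta t$ with $C=\min\{Q,N+1\}$, such that the bound $\big\|\int_{t_0}^t\hat{\mathbf p}(\tau)-\mathbf p(\tau)\,\mathrm d\tau\big\|_\infty\le l\Delta t\sum_{c=2}^C\frac1c$ holds for all $t$ in the prediction horizon ($\hat{\mathbf p}(\cdot),\mathbf p(\cdot)$ denoting the piecewise constant functions with the given block values), and, whenever a problem $P_i(h,b_{act})$ arising in the scheme is feasible, the trajectory $(x,u^* )$ obtained from its NLP #1 solution by SUR is $\delta$-feasible. Assumption (B) (terminal set). $\mathcal X_f$ is an admissible $l$-step control invariant ($l$-CI) set for $\phi$: for all $x_0\in\mathcal X_f$ there exist $\{u_0,\dots,u_{l-1}\}\in\mathcal U^l$ and $\mathbf p_0\in\{0,1\}^Q$ with $\sum_{j=1}^Qp_0^j=1$ such that, with $x_{k+1}=\phi(x_k,u_k,\mathbf p_0)$ for $k=0,\dots,l-1$, one has $x_k\in\mathcal X$ and $g(x_k,u_k)\le0$ for $k=0,\dots,l-1$, and $x_l\in\mathcal X_f$. *)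

theory Defs
  imports "HOL-Analysis.Analysis"
begin

definition C2 :: "('a::euclidean_space \<Rightarrow> 'b::euclidean_space) \<Rightarrow> bool" where
  "C2 f \<longleftrightarrow> (\<exists>(f' :: 'a \<Rightarrow> 'a \<Rightarrow>\<^sub>L 'b) (f'' :: 'a \<Rightarrow> 'a \<Rightarrow>\<^sub>L ('a \<Rightarrow>\<^sub>L 'b)).
     (\<forall>x. (f has_derivative blinfun_apply (f' x)) (at x)) \<and>
     (\<forall>x. (f' has_derivative blinfun_apply (f'' x)) (at x)) \<and>
     continuous_on UNIV f'')"

(* A one-step method maps a step size, an autonomous vector field and a state to the next state;
   the defining requirement is the usual consistency of one-step methods (increment function
   tending to the vector field as the step size tends to 0), as satisfied by Euler and
   Runge-Kutta methods. *)
definition one_step_method :: "(real \<Rightarrow> ('a \<Rightarrow> 'a) \<Rightarrow> 'a \<Rightarrow> 'a::euclidean_space) \<Rightarrow> bool" where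
  "one_step_method \<Phi> \<longleftrightarrow>
     (\<forall>F x. C2 F \<longrightarrow> ((\<lambda>\<tau>. (\<Phi> \<tau> F x - x) /\<^sub>R \<tau>) \<longlongrightarrow> F x) (at_right 0))"

(* The Q modes are the elements of the finite linearly ordered index type 'q, so Q = CARD('q). *)
record ('nx, 'nu, 'c, 'q) mpc_data =
  state_set :: "(real^('nx::finite)) set"
  input_set :: "(real^('nu::finite)) set"
  term_set :: "(real^('nx::finite)) set"
  constr :: "real^('nx::finite) \<Rightarrow> real^('nu::finite) \<Rightarrow> real^('c::finite)"
  stage_cost :: "('q::{finite,linorder}) \<Rightarrow> real^('nx::finite) \<Rightarrow> real^('nu::finite) \<Rightarrow> real"
  term_cost :: "real^('nx::finite) \<Rightarrow> real"
  mode_field :: "('q::{finite,linorder}) \<Rightarrow> real^('nx::finite) \<Rightarrow> real^('nu::finite) \<Rightarrow> real^('nx::finite)"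
  phi :: "real^('nx::finite) \<Rightarrow> real^('nu::finite) \<Rightarrow> real^('q::{finite,linorder}) \<Rightarrow> real^('nx::finite)"
  t_init :: real
  t_final :: real
  num_steps :: nat
  min_dwell :: real
  num_blocks :: nat

definition dt :: "('nx::finite, 'nu::finite, 'c::finite, 'q::{finite,linorder}) mpc_data \<Rightarrow> real" where
  "dt D = (t_final D - t_init D) / real (num_steps D)"

definition block_len :: "('nx::finite, 'nu::finite, 'c::finite, 'q::{finite,linorder}) mpc_data \<Rightarrow> nat" where
  "block_len D = nat \<lceil>min_dwell D / dt D\<rceil>"

definition box01 :: "(real^'q) set" where
  "box01 = {b. \<forall>j. 0 \<le> b $ j \<and> b $ j \<le> 1}"

definition standing_data :: "('nx::finite, 'nu::finite, 'c::finite, 'q::{finite,linorder}) mpc_data \<Rightarrow> bool" where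
  "standing_data D \<longleftrightarrow>
     closed (state_set D) \<and> compact (input_set D) \<and> term_set D \<subseteq> state_set D \<and>
     C2 (\<lambda>(x, u). constr D x u) \<and>
     (\<forall>j. C2 (\<lambda>(x, u). stage_cost D j x u)) \<and>
     C2 (term_cost D) \<and>
     (\<forall>j. C2 (\<lambda>(x, u). mode_field D j x u)) \<and>
     (\<exists>\<Phi>. one_step_method \<Phi> \<and>
        (\<forall>x u. \<forall>b\<in>box01. phi D x u b = \<Phi> (dt D) (\<lambda>y. \<Sum>j\<in>UNIV. b $ j *\<^sub>R mode_field D j y u) x)) \<and>
     dt D > 0 \<and> min_dwell D > 0 \<and> num_blocks D * block_len D = num_steps D"

definition horizon :: "('nx::finite, 'nu::finite, 'c::finite, 'q::{finite,linorder}) mpc_data \<Rightarrow> nat \<Rightarrow> nat" where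
  "horizon D h = h + (num_blocks D - 1) * block_len D"

(* h + (m - 1) l \<le> k \<le> h + m l - 1 iff m = (k - h) div l + 1 *)
definition block_idx :: "('nx::finite, 'nu::finite, 'c::finite, 'q::{finite,linorder}) mpc_data \<Rightarrow> nat \<Rightarrow> nat \<Rightarrow> nat" where
  "block_idx D h k = (if k < h then 0 else (k - h) div block_len D + 1)"

(* State, input and multiplier trajectories are functions on nat; only the indices within the
   horizon enter the definitions below. The active mode b_act is None when no mode is imposed. *)
definition cost :: "('nx::finite, 'nu::finite, 'c::finite, 'q::{finite,linorder}) mpc_data \<Rightarrow> nat \<Rightarrow>
    (nat \<Rightarrow> real^'nx) \<Rightarrow> (nat \<Rightarrow> real^'nu) \<Rightarrow> (nat \<Rightarrow> real^('q::{finite,linorder})) \<Rightarrow> real" where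
  "cost D h x u p = term_cost D (x (horizon D h)) +
     (\<Sum>k<horizon D h. \<Sum>j\<in>UNIV. p (block_idx D h k) $ j * stage_cost D j (x k) (u k))"

definition admissible :: "('nx::finite, 'nu::finite, 'c::finite, 'q::{finite,linorder}) mpc_data \<Rightarrow> nat \<Rightarrow>
    (real^('q::{finite,linorder})) option \<Rightarrow> real^'nx \<Rightarrow>
    (nat \<Rightarrow> real^'nx) \<Rightarrow> (nat \<Rightarrow> real^'nu) \<Rightarrow> (nat \<Rightarrow> real^('q::{finite,linorder})) \<Rightarrow> bool" where
  "admissible D h b xt x u p \<longleftrightarrow>
     (\<forall>m<num_blocks D. p m \<in> box01) \<and>
     (\<forall>v. b = Some v \<longrightarrow> p 0 = v) \<and>
     x 0 = xt \<and>
     (\<forall>k<horizon D h.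
        x (Suc k) = phi D (x k) (u k) (p (block_idx D h k)) \<and>
        x k \<in> state_set D \<and> u k \<in> input_set D \<and> (\<forall>i. constr D (x k) (u k) $ i \<le> 0)) \<and>
     x (horizon D h) \<in> term_set D \<and>
     (\<forall>m<num_blocks D. (\<Sum>j\<in>UNIV. p m $ j) = 1)"

definition feasible :: "('nx::finite, 'nu::finite, 'c::finite, 'q::{finite,linorder}) mpc_data \<Rightarrow> nat \<Rightarrow>
    (real^('q::{finite,linorder})) option \<Rightarrow> real^'nx \<Rightarrow> bool" where
  "feasible D h b xt \<longleftrightarrow> (\<exists>x u p. admissible D h b xt x u p)"

definition optimal :: "('nx::finite, 'nu::finite, 'c::finite, 'q::{finite,linorder}) mpc_data \<Rightarrow> nat \<Rightarrow>
    (real^('q::{finite,linorder})) option \<Rightarrow> real^'nx \<Rightarrow>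
    (nat \<Rightarrow> real^'nx) \<Rightarrow> (nat \<Rightarrow> real^'nu) \<Rightarrow> (nat \<Rightarrow> real^('q::{finite,linorder})) \<Rightarrow> bool" where
  "optimal D h b xt x u p \<longleftrightarrow> admissible D h b xt x u p \<and>
     (\<forall>x' u' p'. admissible D h b xt x' u' p' \<longrightarrow> cost D h x u p \<le> cost D h x' u' p')"

definition feasible_fixed :: "('nx::finite, 'nu::finite, 'c::finite, 'q::{finite,linorder}) mpc_data \<Rightarrow> nat \<Rightarrow>
    (real^('q::{finite,linorder})) option \<Rightarrow> real^'nx \<Rightarrow> (nat \<Rightarrow> real^('q::{finite,linorder})) \<Rightarrow> bool" where
  "feasible_fixed D h b xt p \<longleftrightarrow> (\<exists>x u. admissible D h b xt x u p)"

definition optimal_fixed :: "('nx::finite, 'nu::finite, 'c::finite, 'q::{finite,linorder}) mpc_data \<Rightarrow> nat \<Rightarrow>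
    (real^('q::{finite,linorder})) option \<Rightarrow> real^'nx \<Rightarrow> (nat \<Rightarrow> real^('q::{finite,linorder})) \<Rightarrow>
    (nat \<Rightarrow> real^'nx) \<Rightarrow> (nat \<Rightarrow> real^'nu) \<Rightarrow> bool" where
  "optimal_fixed D h b xt p x u \<longleftrightarrow> admissible D h b xt x u p \<and>
     (\<forall>x' u'. admissible D h b xt x' u' p \<longrightarrow> cost D h x u p \<le> cost D h x' u' p)"

(* Sum-up rounding with block length w: the mode j chosen in block m is the smallest
   maximizer of s_m. *)
fun sur :: "real \<Rightarrow> (nat \<Rightarrow> real^('q::{finite,linorder})) \<Rightarrow> nat \<Rightarrow> real^('q::{finite,linorder})" where
  "sur w ph m =
     (let s = (\<lambda>j. ((\<Sum>r\<le>m. ph r $ j) - (\<Sum>r<m. sur w ph r $ j)) * w)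
      in \<chi> j. if j = (LEAST j'. \<forall>i. s i \<le> s j') then 1 else 0)"

declare sur.simps [simp del]

definition rounded :: "('nx::finite, 'nu::finite, 'c::finite, 'q::{finite,linorder}) mpc_data \<Rightarrow>
    (nat \<Rightarrow> real^('q::{finite,linorder})) \<Rightarrow> nat \<Rightarrow> real^('q::{finite,linorder})" where
  "rounded D ph = sur (real (block_len D) * dt D) ph"

primrec rollout :: "('nx::finite, 'nu::finite, 'c::finite, 'q::{finite,linorder}) mpc_data \<Rightarrow> nat \<Rightarrow> real^'nx \<Rightarrow>
    (nat \<Rightarrow> real^'nu) \<Rightarrow> (nat \<Rightarrow> real^('q::{finite,linorder})) \<Rightarrow> nat \<Rightarrow> real^'nx" where
  "rollout D h xt u p 0 = xt"
| "rollout D h xt u p (Suc k) = phi D (rollout D h xt u p k) (u k) (p (block_idx D h k))"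

(* The distance of the optimal solution (xh, us) to the boundary of the feasible region enters
   only through what it has to ensure: the trajectory after rounding satisfies all constraints. *)
definition delta_feasible_traj :: "('nx::finite, 'nu::finite, 'c::finite, 'q::{finite,linorder}) mpc_data \<Rightarrow> nat \<Rightarrow>
    (real^('q::{finite,linorder})) option \<Rightarrow> real^'nx \<Rightarrow>
    (nat \<Rightarrow> real^'nx) \<Rightarrow> (nat \<Rightarrow> real^'nu) \<Rightarrow> (nat \<Rightarrow> real^('q::{finite,linorder})) \<Rightarrow> bool" where
  "delta_feasible_traj D h b xt xh us ph \<longleftrightarrow>
     (let p = rounded D ph; x = rollout D h xt us p in
      \<exists>\<delta>\<^sub>1 \<delta>\<^sub>2 \<delta>\<^sub>3. \<delta>\<^sub>1 \<ge> 0 \<and> \<delta>\<^sub>2 \<ge> 0 \<and> \<delta>\<^sub>3 \<ge> 0 \<and>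
        (\<forall>k\<le>horizon D h. infnorm (x k - xh k) \<le> \<delta>\<^sub>1) \<and>
        \<bar>cost D h x us p - cost D h xh us ph\<bar> \<le> \<delta>\<^sub>2 \<and>
        (\<forall>k<horizon D h. infnorm (constr D (x k) (us k) - constr D (xh k) (us k)) \<le> \<delta>\<^sub>3) \<and>
        admissible D h b xt x us p)"

(* Optimal solutions need not be unique, so delta-feasibility of a problem refers to the
   solution (xh, us, ph) returned for it. *)
definition delta_feasible :: "('nx::finite, 'nu::finite, 'c::finite, 'q::{finite,linorder}) mpc_data \<Rightarrow> nat \<Rightarrow>
    (real^('q::{finite,linorder})) option \<Rightarrow> real^'nx \<Rightarrow>
    (nat \<Rightarrow> real^'nx) \<Rightarrow> (nat \<Rightarrow> real^'nu) \<Rightarrow> (nat \<Rightarrow> real^('q::{finite,linorder})) \<Rightarrow> bool" where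
  "delta_feasible D h b xt xh us ph \<longleftrightarrow>
     feasible D h b xt \<and> optimal D h b xt xh us ph \<and> delta_feasible_traj D h b xt xh us ph"

(* All quantities generated by the scheme, indexed by the sampling instant. *)
record ('nx, 'nu, 'q) mpc_run =
  run_h :: "nat \<Rightarrow> nat"
  run_bact :: "nat \<Rightarrow> (real^('q::{finite,linorder})) option"
  run_meas :: "nat \<Rightarrow> real^('nx::finite)"
  run_xh :: "nat \<Rightarrow> nat \<Rightarrow> real^('nx::finite)"
  run_us :: "nat \<Rightarrow> nat \<Rightarrow> real^('nu::finite)"
  run_ph :: "nat \<Rightarrow> nat \<Rightarrow> real^('q::{finite,linorder})"
  run_p :: "nat \<Rightarrow> nat \<Rightarrow> real^('q::{finite,linorder})"
  run_x :: "nat \<Rightarrow> nat \<Rightarrow> real^('nx::finite)"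
  run_u :: "nat \<Rightarrow> nat \<Rightarrow> real^('nu::finite)"

(* The results of the two optimization steps are unspecified when the respective problem is
   infeasible. *)
definition mpc_scheme :: "('nx::finite, 'nu::finite, 'c::finite, 'q::{finite,linorder}) mpc_data \<Rightarrow>
    ('nx, 'nu, 'q) mpc_run \<Rightarrow> bool" where
  "mpc_scheme D R \<longleftrightarrow>
     run_h R 0 = block_len D \<and> run_bact R 0 = None \<and>
     (\<forall>i. (feasible D (run_h R i) (run_bact R i) (run_meas R i) \<longrightarrow>
            optimal D (run_h R i) (run_bact R i) (run_meas R i) (run_xh R i) (run_us R i) (run_ph R i)) \<and>
          run_p R i = rounded D (run_ph R i) \<and>
          (feasible_fixed D (run_h R i) (run_bact R i) (run_meas R i) (run_p R i) \<longrightarrow>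
            optimal_fixed D (run_h R i) (run_bact R i) (run_meas R i) (run_p R i) (run_x R i) (run_u R i)) \<and>
          run_meas R (Suc i) = phi D (run_meas R i) (run_u R i 0) (run_p R i 0) \<and>
          (if run_h R i - 1 = 0
           then run_h R (Suc i) = block_len D \<and> run_bact R (Suc i) = None
           else run_h R (Suc i) = run_h R i - 1 \<and> run_bact R (Suc i) = Some (run_p R i 0)))"

definition pw_const :: "('nx::finite, 'nu::finite, 'c::finite, 'q::{finite,linorder}) mpc_data \<Rightarrow> nat \<Rightarrow>
    (nat \<Rightarrow> real^('q::{finite,linorder})) \<Rightarrow> real \<Rightarrow> real^('q::{finite,linorder})" where
  "pw_const D h p \<tau> = p (block_idx D h (nat \<lfloor>(\<tau> - t_init D) / dt D\<rfloor>))"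

definition sur_const :: "('nx::finite, 'nu::finite, 'c::finite, 'q::{finite,linorder}) mpc_data \<Rightarrow> real" where
  "sur_const D = (\<Sum>c = 2..min CARD('q) (num_steps D + 1). 1 / real c)"

(* For Q = 1 the sum is empty and the bound on the dwell time is read as being infinite.
   Time is measured relative to the current sampling instant: each prediction horizon starts
   at t_init. *)
definition dwell_time_assumption :: "('nx::finite, 'nu::finite, 'c::finite, 'q::{finite,linorder}) mpc_data \<Rightarrow>
    ('nx, 'nu, 'q) mpc_run \<Rightarrow> real \<Rightarrow> bool" where
  "dwell_time_assumption D R \<epsilon> \<longleftrightarrow>
     (sur_const D \<noteq> 0 \<longrightarrow> min_dwell D \<le> \<epsilon> / sur_const D - dt D) \<and>
     (\<forall>i. feasible D (run_h R i) (run_bact R i) (run_meas R i) \<longrightarrow>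
        (\<forall>t\<in>{t_init D .. t_init D + real (horizon D (run_h R i)) * dt D}.
           infnorm (integral {t_init D..t}
              (\<lambda>\<tau>. pw_const D (run_h R i) (run_ph R i) \<tau> - pw_const D (run_h R i) (run_p R i) \<tau>))
            \<le> real (block_len D) * dt D * sur_const D) \<and>
        delta_feasible_traj D (run_h R i) (run_bact R i) (run_meas R i) (run_xh R i) (run_us R i) (run_ph R i))"

definition l_CI :: "('nx::finite, 'nu::finite, 'c::finite, 'q::{finite,linorder}) mpc_data \<Rightarrow> (real^'nx) set \<Rightarrow> bool" where
  "l_CI D S \<longleftrightarrow>
     (\<forall>x\<^sub>0\<in>S. \<exists>u p\<^sub>0. (\<forall>k<block_len D. u k \<in> input_set D) \<and>
        (\<forall>j. p\<^sub>0 $ j \<in> {0, 1}) \<and> (\<Sum>j\<in>UNIV. p\<^sub>0 $ j) = 1 \<and>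
        (\<exists>x. x 0 = x\<^sub>0 \<and>
           (\<forall>k<block_len D. x (Suc k) = phi D (x k) (u k) p\<^sub>0 \<and>
              x k \<in> state_set D \<and> (\<forall>i. constr D (x k) (u k) $ i \<le> 0)) \<and>
           x (block_len D) \<in> S))"

end

theory Submission
  imports Defs
begin

text \<open>
  Assumption (A) turns feasibility of a problem into its \<open>\<delta>\<close>-feasibility, so only plain
  feasibility has to be propagated from one instant to the next. The solution of NLP #2 provides
  the candidate for the next instant. While a block is being traversed, it suffices to drop its first
  step: the active mode is the first block of the remaining trajectory. When the block is exhausted,
  all remaining blocks move up by one position, and the \<open>l\<close> steps that bring the
  terminal state back into the terminal set under one fixed mode provide the new last block.
\<close>

lemma standing_data_pos:
  assumes "standing_data D"
  shows "0 < block_len D" and "0 < num_blocks D"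
proof -
  have "0 < dt D" and eq: "num_blocks D * block_len D = num_steps D"
    using assms by (auto simp: standing_data_def)
  \<comment> \<open>Division by zero yields 0, so \<open>num_steps D = 0\<close> would force
    \<open>dt D = 0\<close>.\<close>
  then have "num_steps D \<noteq> 0"
    by (metis dt_def div_by_0 less_irrefl of_nat_0)
  with eq show "0 < block_len D" "0 < num_blocks D"
    by (auto intro: Nat.gr0I)
qed

text \<open>The right-hand side is the nominal measurement update, so the next measured state lies
  on the predicted trajectory.\<close>

lemma admissible_first_step:
  assumes "admissible D h b xt x u p" and "0 < h"
  shows "x 1 = phi D xt (u 0) (p 0)"
  using assms by (auto simp: admissible_def horizon_def block_idx_def)

text \<open>Only block 0 gets shorter, and \<open>1 < h\<close> keeps it nonempty. No block is
  renumbered, so the same \<open>p\<close> serves and its entry 0 is the imposed mode.\<close>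

lemma admissible_drop_first_step:
  assumes adm: "admissible D h b xt x u p" and "1 < h"
  shows "admissible D (h - 1) (Some (p 0)) (x 1) (\<lambda>k. x (Suc k)) (\<lambda>k. u (Suc k)) p"
proof -
  have hor: "horizon D h = Suc (horizon D (h - 1))"
    and idx: "block_idx D h (Suc k) = block_idx D (h - 1) k" for k
    using \<open>1 < h\<close> by (auto simp: horizon_def block_idx_def)
  have step: "x (Suc k) = phi D (x k) (u k) (p (block_idx D h k)) \<and>
      x k \<in> state_set D \<and> u k \<in> input_set D \<and> (\<forall>i. constr D (x k) (u k) $ i \<le> 0)"
    if "k < Suc (horizon D (h - 1))" for k
    using adm that unfolding admissible_def hor by blast
  have "x (Suc (Suc k)) = phi D (x (Suc k)) (u (Suc k)) (p (block_idx D (h - 1) k)) \<and>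
      x (Suc k) \<in> state_set D \<and> u (Suc k) \<in> input_set D \<and>
      (\<forall>i. constr D (x (Suc k)) (u (Suc k)) $ i \<le> 0)" if "k < horizon D (h - 1)" for k
    using step[OF Suc_mono[OF that]] unfolding idx .
  moreover have "x (Suc (horizon D (h - 1))) \<in> term_set D"
    using adm unfolding admissible_def hor by blast
  moreover have "(\<forall>m<num_blocks D. p m \<in> box01) \<and> (\<forall>m<num_blocks D. (\<Sum>j\<in>UNIV. p m $ j) = 1)"
    using adm unfolding admissible_def by blast
  ultimately show ?thesis
    unfolding admissible_def by (simp only: option.inject One_nat_def) blast
qed

text \<open>A first block of full length makes the block grid uniform, which absorbs the special
  case of block 0.\<close>

lemma block_idx_block_len:
  assumes "0 < block_len D"
  shows "block_idx D (block_len D) k = k div block_len D"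
  using assms by (auto simp: block_idx_def le_div_geq)

text \<open>With \<open>h = 1\<close>, block 0 consists of the applied step alone, so what remains
  is whole blocks. The old block 1 becomes the first one and may carry another mode, hence
  \<open>None\<close>.\<close>

lemma feasible_append_terminal_block:
  assumes adm: "admissible D 1 b xt x u p" and CI: "l_CI D (term_set D)"
    and l: "0 < block_len D" and M: "0 < num_blocks D"
  shows "feasible D (block_len D) None (x 1)"
proof -
  define l M n where "l = block_len D" and "M = num_blocks D" and "n = (M - 1) * l"
  have hor1: "horizon D 1 = Suc n" and horl: "horizon D (block_len D) = l + n"
    by (simp_all add: horizon_def l_def M_def n_def)
  have l0: "0 < l" and M0: "0 < M"
    using l M by (simp_all add: l_def M_def)
  \<comment> \<open>Compared with \<open>idxl\<close>, a shift by one time step is a shift by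
    exactly one block; this is why \<open>p'\<close> below uses \<open>p (Suc m)\<close>.\<close>
  have idx1: "block_idx D 1 (Suc k) = Suc (k div l)" for k
    by (simp add: block_idx_def l_def)
  have idxl: "block_idx D (block_len D) k = k div l" for k
    using block_idx_block_len[OF l] by (simp add: l_def)
  have box: "p m \<in> box01" and one: "(\<Sum>j\<in>UNIV. p m $ j) = 1" if "m < M" for m
    using adm that by (auto simp: admissible_def M_def)
  have step: "x (Suc k) = phi D (x k) (u k) (p (block_idx D 1 k))" "x k \<in> state_set D"
    "u k \<in> input_set D" "\<forall>i. constr D (x k) (u k) $ i \<le> 0" if "k < Suc n" for k
    using adm that hor1 by (auto simp: admissible_def)
  have xn: "x (Suc n) \<in> term_set D"
    using adm unfolding admissible_def hor1 by blast
  obtain v q y where v: "\<forall>k<l. v k \<in> input_set D"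
    and q: "\<forall>j. q $ j \<in> {0, 1}" "(\<Sum>j\<in>UNIV. q $ j) = 1"
    and y0: "y 0 = x (Suc n)"
    and y: "\<forall>k<l. y (Suc k) = phi D (y k) (v k) q \<and>
      y k \<in> state_set D \<and> (\<forall>i. constr D (y k) (v k) $ i \<le> 0)"
    and yl: "y l \<in> term_set D"
    using bspec[OF CI[unfolded l_CI_def, folded l_def] xn] by (elim exE conjE) (rule that)
  define x' u' p' where "x' = (\<lambda>k. if k < n then x (Suc k) else y (k - n))"
    and "u' = (\<lambda>k. if k < n then u (Suc k) else v (k - n))"
    and "p' = (\<lambda>m. if m < M - 1 then p (Suc m) else q)"
  have x'_Suc: "x' (Suc k) = phi D (x' k) (u' k) (p' (k div l))"
    and x'_state: "x' k \<in> state_set D" and u'_input: "u' k \<in> input_set D"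
    and constr': "\<forall>i. constr D (x' k) (u' k) $ i \<le> 0" if k: "k < l + n" for k
  proof -
    consider "k < n" | "n \<le> k" by linarith
    then have "x' (Suc k) = phi D (x' k) (u' k) (p' (k div l)) \<and> x' k \<in> state_set D \<and>
      u' k \<in> input_set D \<and> (\<forall>i. constr D (x' k) (u' k) $ i \<le> 0)"
    proof cases
      case 1
      \<comment> \<open>As \<open>n = (M - 1) * l\<close>, the seam between old and new steps is
        also the seam between old and new blocks.\<close>
      then have "k div l < M - 1"
        using l0 by (simp add: n_def div_less_iff_less_mult)
      \<comment> \<open>At \<open>Suc k = n\<close> the definition of \<open>x'\<close> already
        switches to \<open>y\<close>; the pieces agree there because \<open>y\<close> starts at the
        old terminal state.\<close>
      moreover have "x' (Suc k) = x (Suc (Suc k))"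
        using 1 y0 by (cases "Suc k = n") (auto simp: x'_def)
      ultimately show ?thesis
        using 1 step[of "Suc k"] idx1[of k] by (simp add: x'_def u'_def p'_def)
    next
      case 2
      then have "\<not> k div l < M - 1"
        using l0 by (simp add: n_def div_less_iff_less_mult)
      then show ?thesis
        using 2 k v[rule_format, of "k - n"] y[rule_format, of "k - n"]
        by (simp add: x'_def u'_def p'_def Suc_diff_le)
    qed
    then show "x' (Suc k) = phi D (x' k) (u' k) (p' (k div l))" "x' k \<in> state_set D"
      "u' k \<in> input_set D" "\<forall>i. constr D (x' k) (u' k) $ i \<le> 0"
      by auto
  qed
  have "q \<in> box01"
    unfolding box01_def
  proof (intro CollectI allI)
    fix j show "0 \<le> q $ j \<and> q $ j \<le> 1" using q(1)[rule_format, of j] by auto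
  qed
  then have "p' m \<in> box01" "(\<Sum>j\<in>UNIV. p' m $ j) = 1" for m
    using box[of "Suc m"] one[of "Suc m"] q(2) by (auto simp: p'_def)
  moreover have "x' 0 = x 1"
    using y0 by (auto simp: x'_def)
  moreover have "x' (l + n) \<in> term_set D"
    using yl by (simp add: x'_def)
  ultimately have "admissible D (block_len D) None (x 1) x' u' p'"
    unfolding admissible_def horl idxl using x'_Suc x'_state u'_input constr' by auto
  then show ?thesis
    unfolding feasible_def by blast
qed


theorem theorem2:
  fixes D :: "('nx::finite, 'nu::finite, 'c::finite, 'q::{finite,linorder}) mpc_data"
    and R :: "('nx, 'nu, 'q) mpc_run"
    and \<epsilon> :: real
  assumes "standing_data D"
    and "mpc_scheme D R"
    and "\<epsilon> > 0"
    and "dwell_time_assumption D R \<epsilon>"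
    and "l_CI D (term_set D)"
    and "feasible D (block_len D) None (run_meas R 0)"
  shows "\<forall>i. delta_feasible D (run_h R i) (run_bact R i) (run_meas R i)
               (run_xh R i) (run_us R i) (run_ph R i)"
proof -
  have h0: "run_h R 0 = block_len D" and b0: "run_bact R 0 = None"
    using assms(2) unfolding mpc_scheme_def by blast+
  have opt: "optimal D (run_h R i) (run_bact R i) (run_meas R i) (run_xh R i) (run_us R i) (run_ph R i)"
    if "feasible D (run_h R i) (run_bact R i) (run_meas R i)" for i
    using that assms(2) unfolding mpc_scheme_def by blast
  have opt_fixed: "optimal_fixed D (run_h R i) (run_bact R i) (run_meas R i) (run_p R i) (run_x R i) (run_u R i)"
    if "feasible_fixed D (run_h R i) (run_bact R i) (run_meas R i) (run_p R i)" for i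
    using that assms(2) unfolding mpc_scheme_def by blast
  have p_eq: "run_p R i = rounded D (run_ph R i)"
    and meas: "run_meas R (Suc i) = phi D (run_meas R i) (run_u R i 0) (run_p R i 0)"
    and next_pair: "if run_h R i - 1 = 0
      then run_h R (Suc i) = block_len D \<and> run_bact R (Suc i) = None
      else run_h R (Suc i) = run_h R i - 1 \<and> run_bact R (Suc i) = Some (run_p R i 0)" for i
    using assms(2) unfolding mpc_scheme_def by blast+
  have traj: "delta_feasible_traj D (run_h R i) (run_bact R i) (run_meas R i)
      (run_xh R i) (run_us R i) (run_ph R i)"
    if "feasible D (run_h R i) (run_bact R i) (run_meas R i)" for i
    using that assms(4) unfolding dwell_time_assumption_def by blast
  note pos = standing_data_pos[OF assms(1)]
  \<comment> \<open>Positivity of \<open>run_h R i\<close> is carried along: it places the applied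
    step in block 0 and leaves only the cases \<open>run_h R i = 1\<close> and
    \<open>1 < run_h R i\<close>.\<close>
  have "0 < run_h R i \<and> feasible D (run_h R i) (run_bact R i) (run_meas R i)" for i
  proof (induction i)
    case 0
    then show ?case
      using assms(6) pos h0 b0 by simp
  next
    case (Suc i)
    then have h: "0 < run_h R i"
      and feas: "feasible D (run_h R i) (run_bact R i) (run_meas R i)" by auto
    \<comment> \<open>The rollout of the NLP #1 inputs under the rounded modes is a feasible point
      of NLP #2.\<close>
    have "feasible_fixed D (run_h R i) (run_bact R i) (run_meas R i) (run_p R i)"
      using traj[OF feas] unfolding delta_feasible_traj_def feasible_fixed_def Let_def p_eq by blast
    then have adm: "admissible D (run_h R i) (run_bact R i) (run_meas R i) (run_x R i) (run_u R i) (run_p R i)"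
      using opt_fixed unfolding optimal_fixed_def by blast
    have meas': "run_meas R (Suc i) = run_x R i 1"
      unfolding meas admissible_first_step[OF adm h] ..
    show ?case
    proof (cases "run_h R i = 1")
      case True
      then have "run_h R (Suc i) = block_len D" "run_bact R (Suc i) = None"
        using next_pair[of i] by simp_all
      then show ?thesis
        using feasible_append_terminal_block[OF adm[unfolded True] assms(5) pos] meas' pos by simp
    next
      case False
      then have "1 < run_h R i" using h by simp
      then have "run_h R (Suc i) = run_h R i - 1" "run_bact R (Suc i) = Some (run_p R i 0)"
        using next_pair[of i] by simp_all
      moreover have "feasible D (run_h R i - 1) (Some (run_p R i 0)) (run_x R i 1)"
        using admissible_drop_first_step[OF adm \<open>1 < run_h R i\<close>] unfolding feasible_def by blast
      ultimately show ?thesis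
        using \<open>1 < run_h R i\<close> meas' by simp
    qed
  qed
  then show ?thesis
    using opt traj unfolding delta_feasible_def by blast
qed

end
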